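(* Every interval order preference relation $\succ$ defined using an ERO formula has a weak order extension $\succ'$ (a weak order with $\succ\,\subseteq\,\succ'$) defined using an ERO formula. The ERO formula defining $\succ'$ can be computed, from the ERO formula defining $\succ$, in exponential time.
   Context: A relation schema $R(A_1,\dots,A_k)$ assigns each attribute $A_i$ a domain $U_i$, either a countably infinite set $D$ of uninterpreted constants or the set $\mathbb{Q}$ of rational numbers; tuples are elements of $U=U_1\times\cdots\times U_k$. A preference relation over $R$ is any subset of $U\times U$ (possibly infinite). It is an interval order if it is irreflexive, transitive, and for all $x,y,z,w$, $(x\succ y\wedge z\succ w)$ implies $(x\succ w\vee z\succ y)$. It is a weak order if it is irreflexive, transitive, and for all $x,y,z$, $(x\not\succ y\wedge y\not\succ z)$ implies $x\not\succ z$. A preference formula $C(t_1,t_2)$ is a first-order formula and defines the preference relation $\succ_C$ by: $t_1\succ_C t_2$ iff $C(t_1,t_2)$ holds. An ERO formula is a first-order formula using only built-in predicates, whose atomic formulas are of two kinds: equality constraints $x=y$, $x\ne y$, $x=c$, $x\ne c$, with $x,y$ variables ranging over $D$ and $c\in D$ a constant; and rational-order constraints $x\,\lambda\,y$ or $x\,\lambda\,c$, with $\lambda\in\{=,\ne,<,>,\le,\ge\}$, $x,y$ variables ranging over $\mathbb{Q}$ and $c\in\mathbb{Q}$ a constant. *)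

theory Defs
  imports Complex_Main "HOL-Computational_Algebra.Polynomial"
begin

section \<open>Relation schemas and preference relations\<close>

text \<open>The type \<open>'d\<close> plays the role of the domain of uninterpreted constants. A schema lists the
  domains of its attributes.\<close>

datatype sort = DSort | QSort

type_synonym schema = "sort list"

datatype 'd val = DVal 'd | QVal (rat_of: rat)

fun sort_of :: "'d val \<Rightarrow> sort" where
  "sort_of (DVal d) = DSort"
| "sort_of (QVal q) = QSort"

definition tuples :: "schema \<Rightarrow> 'd val list set" where
  "tuples R = {t. map sort_of t = R}"

text \<open>The axioms are relativised to a carrier \<open>U\<close>, the set of all tuples of a schema. For negative
  transitivity this matters: with unrestricted variables, a tuple outside \<open>U\<close> as \<open>y\<close> would force
  the relation to be empty.\<close>

definition interval_order_on :: "'a set \<Rightarrow> 'a rel \<Rightarrow> bool" where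
  "interval_order_on U r \<longleftrightarrow> r \<subseteq> U \<times> U \<and> irrefl_on U r \<and> trans_on U r \<and>
     (\<forall>x\<in>U. \<forall>y\<in>U. \<forall>z\<in>U. \<forall>w\<in>U. (x, y) \<in> r \<and> (z, w) \<in> r \<longrightarrow> (x, w) \<in> r \<or> (z, y) \<in> r)"

definition weak_order_on :: "'a set \<Rightarrow> 'a rel \<Rightarrow> bool" where
  "weak_order_on U r \<longleftrightarrow> r \<subseteq> U \<times> U \<and> irrefl_on U r \<and> trans_on U r \<and>
     (\<forall>x\<in>U. \<forall>y\<in>U. \<forall>z\<in>U. (x, y) \<notin> r \<and> (y, z) \<notin> r \<longrightarrow> (x, z) \<notin> r)"


section \<open>ERO formulas\<close>

text \<open>In a formula \<open>C(t\<^sub>1, t\<^sub>2)\<close>, \<open>Fst i\<close> and \<open>Snd i\<close> stand for the attribute with index \<open>i\<close>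
  (counted from 0) of \<open>t\<^sub>1\<close> and of \<open>t\<^sub>2\<close>. \<open>Bnd s n\<close> is the \<open>n\<close>-th auxiliary variable of sort \<open>s\<close>;
  only auxiliary variables can be quantified.\<close>

datatype var = Fst nat | Snd nat | Bnd sort nat

datatype 'c rhs = Var var | Cst 'c

datatype eqrel = EqD | NeD

datatype ordrel = EqQ | NeQ | LtQ | GtQ | LeQ | GeQ

datatype 'd fm =
    DAtom eqrel var "'d rhs"
  | QAtom ordrel var "rat rhs"
  | Neg "'d fm"
  | Conj "'d fm" "'d fm"
  | Disj "'d fm" "'d fm"
  | Impl "'d fm" "'d fm"
  | Ex sort nat "'d fm"
  | All sort nat "'d fm"

fun eqrel_sem :: "eqrel \<Rightarrow> 'a \<Rightarrow> 'a \<Rightarrow> bool" where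
  "eqrel_sem EqD = (=)"
| "eqrel_sem NeD = (\<noteq>)"

fun ordrel_sem :: "ordrel \<Rightarrow> rat \<Rightarrow> rat \<Rightarrow> bool" where
  "ordrel_sem EqQ = (=)"
| "ordrel_sem NeQ = (\<noteq>)"
| "ordrel_sem LtQ = (<)"
| "ordrel_sem GtQ = (>)"
| "ordrel_sem LeQ = (\<le>)"
| "ordrel_sem GeQ = (\<ge>)"

fun rhs_val :: "('c \<Rightarrow> 'd val) \<Rightarrow> (var \<Rightarrow> 'd val) \<Rightarrow> 'c rhs \<Rightarrow> 'd val" where
  "rhs_val mk e (Var y) = e y"
| "rhs_val mk e (Cst c) = mk c"

fun holds :: "(var \<Rightarrow> 'd val) \<Rightarrow> 'd fm \<Rightarrow> bool" where
  "holds e (DAtom r x u) = eqrel_sem r (e x) (rhs_val DVal e u)"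
| "holds e (QAtom r x u) = ordrel_sem r (rat_of (e x)) (rat_of (rhs_val QVal e u))"
| "holds e (Neg \<phi>) = (\<not> holds e \<phi>)"
| "holds e (Conj \<phi> \<psi>) = (holds e \<phi> \<and> holds e \<psi>)"
| "holds e (Disj \<phi> \<psi>) = (holds e \<phi> \<or> holds e \<psi>)"
| "holds e (Impl \<phi> \<psi>) = (holds e \<phi> \<longrightarrow> holds e \<psi>)"
| "holds e (Ex s n \<phi>) = (\<exists>v. sort_of v = s \<and> holds (e(Bnd s n := v)) \<phi>)"
| "holds e (All s n \<phi>) = (\<forall>v. sort_of v = s \<longrightarrow> holds (e(Bnd s n := v)) \<phi>)"

fun rhs_vars :: "'c rhs \<Rightarrow> var set" where
  "rhs_vars (Var y) = {y}"
| "rhs_vars (Cst c) = {}"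

fun free_vars :: "'d fm \<Rightarrow> var set" where
  "free_vars (DAtom r x u) = insert x (rhs_vars u)"
| "free_vars (QAtom r x u) = insert x (rhs_vars u)"
| "free_vars (Neg \<phi>) = free_vars \<phi>"
| "free_vars (Conj \<phi> \<psi>) = free_vars \<phi> \<union> free_vars \<psi>"
| "free_vars (Disj \<phi> \<psi>) = free_vars \<phi> \<union> free_vars \<psi>"
| "free_vars (Impl \<phi> \<psi>) = free_vars \<phi> \<union> free_vars \<psi>"
| "free_vars (Ex s n \<phi>) = free_vars \<phi> - {Bnd s n}"
| "free_vars (All s n \<phi>) = free_vars \<phi> - {Bnd s n}"

fun var_sorted :: "schema \<Rightarrow> sort \<Rightarrow> var \<Rightarrow> bool" where
  "var_sorted R s (Fst i) = (i < length R \<and> R ! i = s)"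
| "var_sorted R s (Snd i) = (i < length R \<and> R ! i = s)"
| "var_sorted R s (Bnd s' n) = (s' = s)"

fun well_sorted :: "schema \<Rightarrow> 'd fm \<Rightarrow> bool" where
  "well_sorted R (DAtom r x u) = (\<forall>y \<in> insert x (rhs_vars u). var_sorted R DSort y)"
| "well_sorted R (QAtom r x u) = (\<forall>y \<in> insert x (rhs_vars u). var_sorted R QSort y)"
| "well_sorted R (Neg \<phi>) = well_sorted R \<phi>"
| "well_sorted R (Conj \<phi> \<psi>) = (well_sorted R \<phi> \<and> well_sorted R \<psi>)"
| "well_sorted R (Disj \<phi> \<psi>) = (well_sorted R \<phi> \<and> well_sorted R \<psi>)"
| "well_sorted R (Impl \<phi> \<psi>) = (well_sorted R \<phi> \<and> well_sorted R \<psi>)"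
| "well_sorted R (Ex s n \<phi>) = well_sorted R \<phi>"
| "well_sorted R (All s n \<phi>) = well_sorted R \<phi>"

definition ERO :: "schema \<Rightarrow> 'd fm \<Rightarrow> bool" where
  "ERO R C \<longleftrightarrow> well_sorted R C \<and> free_vars C \<subseteq> range Fst \<union> range Snd"

fun tuple_env :: "'d val list \<Rightarrow> 'd val list \<Rightarrow> var \<Rightarrow> 'd val" where
  "tuple_env t1 t2 (Fst i) = t1 ! i"
| "tuple_env t1 t2 (Snd i) = t2 ! i"
| "tuple_env t1 t2 (Bnd s n) = undefined"

definition pref :: "schema \<Rightarrow> 'd fm \<Rightarrow> 'd val list rel" where
  "pref R C = {(t1, t2). t1 \<in> tuples R \<and> t2 \<in> tuples R \<and> holds (tuple_env t1 t2) C}"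


section \<open>Formulas as words\<close>

text \<open>Formulas are written in prefix notation over a finite alphabet, all numbers in binary with
  the least significant bit first and closed by \<open>TEnd\<close>.\<close>

datatype token =
    TBit bool | TEnd | TSign bool
  | TFst | TSnd | TBnd sort
  | TVar | TCst
  | TDAtom eqrel | TQAtom ordrel
  | TNeg | TConj | TDisj | TImpl | TEx | TAll

instance token :: finite
proof
  have s: "x \<in> {DSort, QSort}" for x by (cases x) auto
  have e: "x \<in> {EqD, NeD}" for x by (cases x) auto
  have o: "x \<in> {EqQ, NeQ, LtQ, GtQ, LeQ, GeQ}" for x by (cases x) auto
  have "t \<in> TBit ` UNIV \<union> TSign ` UNIV \<union> TBnd ` {DSort, QSort} \<union> TDAtom ` {EqD, NeD}
      \<union> TQAtom ` {EqQ, NeQ, LtQ, GtQ, LeQ, GeQ}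
      \<union> {TEnd, TFst, TSnd, TVar, TCst, TNeg, TConj, TDisj, TImpl, TEx, TAll}" for t
    using s e o by (cases t) blast+
  then have "(UNIV :: token set) \<subseteq> TBit ` UNIV \<union> TSign ` UNIV \<union> TBnd ` {DSort, QSort}
      \<union> TDAtom ` {EqD, NeD} \<union> TQAtom ` {EqQ, NeQ, LtQ, GtQ, LeQ, GeQ}
      \<union> {TEnd, TFst, TSnd, TVar, TCst, TNeg, TConj, TDisj, TImpl, TEx, TAll}" by blast
  then show "finite (UNIV :: token set)" by (rule finite_subset) simp
qed

fun bits :: "nat \<Rightarrow> bool list" where
  "bits n = (if n = 0 then [] else odd n # bits (n div 2))"

declare bits.simps [simp del]

definition enc_nat :: "nat \<Rightarrow> token list" where
  "enc_nat n = map TBit (bits n) @ [TEnd]"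

definition enc_int :: "int \<Rightarrow> token list" where
  "enc_int z = TSign (z < 0) # enc_nat (nat \<bar>z\<bar>)"

definition enc_rat :: "rat \<Rightarrow> token list" where
  "enc_rat q = enc_int (fst (quotient_of q)) @ enc_int (snd (quotient_of q))"

fun enc_var :: "var \<Rightarrow> token list" where
  "enc_var (Fst i) = TFst # enc_nat i"
| "enc_var (Snd i) = TSnd # enc_nat i"
| "enc_var (Bnd s n) = TBnd s # enc_nat n"

fun enc_rhs :: "('c \<Rightarrow> token list) \<Rightarrow> 'c rhs \<Rightarrow> token list" where
  "enc_rhs enc_c (Var y) = TVar # enc_var y"
| "enc_rhs enc_c (Cst c) = TCst # enc_c c"

text \<open>Since the constants of type \<open>'d\<close> are uninterpreted, writing them down requires names for them;
  \<open>name\<close> assigns to each constant a natural number, which is then written in binary.\<close>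

fun enc_fm :: "('d \<Rightarrow> nat) \<Rightarrow> 'd fm \<Rightarrow> token list" where
  "enc_fm name (DAtom r x u) = TDAtom r # enc_var x @ enc_rhs (\<lambda>c. enc_nat (name c)) u"
| "enc_fm name (QAtom r x u) = TQAtom r # enc_var x @ enc_rhs enc_rat u"
| "enc_fm name (Neg \<phi>) = TNeg # enc_fm name \<phi>"
| "enc_fm name (Conj \<phi> \<psi>) = TConj # enc_fm name \<phi> @ enc_fm name \<psi>"
| "enc_fm name (Disj \<phi> \<psi>) = TDisj # enc_fm name \<phi> @ enc_fm name \<psi>"
| "enc_fm name (Impl \<phi> \<psi>) = TImpl # enc_fm name \<phi> @ enc_fm name \<psi>"
| "enc_fm name (Ex s n \<phi>) = TEx # enc_var (Bnd s n) @ enc_fm name \<phi>"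
| "enc_fm name (All s n \<phi>) = TAll # enc_var (Bnd s n) @ enc_fm name \<phi>"

text \<open>The encoding is unambiguous.\<close>

lemma bits_inject: "bits m = bits n \<Longrightarrow> m = n"
proof (induction m arbitrary: n rule: bits.induct)
  case (1 m)
  show ?case
  proof (cases "m = 0 \<or> n = 0")
    case True
    then show ?thesis using 1(2) by (auto simp: bits.simps[of m] bits.simps[of n] split: if_splits)
  next
    case False
    then have *: "odd m = odd n" "bits (m div 2) = bits (n div 2)"
      using 1(2) by (auto simp: bits.simps[of m] bits.simps[of n])
    then have "m div 2 = n div 2" using 1(1) False by blast
    with *(1) show ?thesis by presburger
  qed
qed

lemma enc_nat_prefix: "enc_nat m @ xs = enc_nat n @ ys \<longleftrightarrow> m = n \<and> xs = ys"
proof -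
  have *: "as = bs \<and> xs = ys" if "map TBit as @ TEnd # xs = map TBit bs @ TEnd # ys" for as bs
    using that
  proof (induction as arbitrary: bs)
    case Nil
    then show ?case by (cases bs) auto
  next
    case (Cons a as)
    then show ?case by (cases bs) auto
  qed
  show ?thesis
  proof
    assume "enc_nat m @ xs = enc_nat n @ ys"
    then have "bits m = bits n \<and> xs = ys" by (intro *) (simp add: enc_nat_def)
    then show "m = n \<and> xs = ys" using bits_inject by blast
  qed simp
qed

lemma enc_int_prefix: "enc_int m @ xs = enc_int n @ ys \<longleftrightarrow> m = n \<and> xs = ys"
  by (auto simp: enc_int_def enc_nat_prefix)

lemma enc_rat_prefix: "enc_rat p @ xs = enc_rat q @ ys \<longleftrightarrow> p = q \<and> xs = ys"
  by (auto simp: enc_rat_def enc_int_prefix quotient_of_inject_eq[symmetric] prod_eq_iff)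

lemma enc_var_prefix: "enc_var x @ xs = enc_var y @ ys \<longleftrightarrow> x = y \<and> xs = ys"
  by (cases x; cases y) (auto simp: enc_nat_prefix)

lemma enc_rhs_prefix:
  assumes "\<And>c d xs ys. enc_c c @ xs = enc_c d @ ys \<longleftrightarrow> c = d \<and> xs = ys"
  shows "enc_rhs enc_c u @ xs = enc_rhs enc_c v @ ys \<longleftrightarrow> u = v \<and> xs = ys"
  by (cases u; cases v) (auto simp: assms enc_var_prefix)

lemma enc_fm_prefix:
  assumes "inj name"
  shows "enc_fm name \<phi> @ xs = enc_fm name \<psi> @ ys \<longleftrightarrow> \<phi> = \<psi> \<and> xs = ys"
proof (induction \<phi> arbitrary: \<psi> xs ys)
  case (DAtom r x u)
  have "enc_nat (name c) @ xs = enc_nat (name d) @ ys \<longleftrightarrow> c = d \<and> xs = ys" for c d xs ys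
    using assms by (auto simp: enc_nat_prefix inj_eq)
  note * = enc_rhs_prefix[of "\<lambda>c. enc_nat (name c)", OF this]
  show ?case by (cases \<psi>) (auto simp: enc_var_prefix *)
next
  case (QAtom r x u)
  show ?case by (cases \<psi>) (auto simp: enc_var_prefix enc_rhs_prefix[of enc_rat, OF enc_rat_prefix])
next
  case (Ex s n \<phi>)
  then show ?case by (cases \<psi>) (auto simp: enc_nat_prefix)
next
  case (All s n \<phi>)
  then show ?case by (cases \<psi>) (auto simp: enc_nat_prefix)
qed (case_tac \<psi>; auto)+

lemma inj_enc_fm: "inj name \<Longrightarrow> inj (enc_fm name)"
  using enc_fm_prefix[of name _ "[]" _ "[]"] by (auto intro: injI)


section \<open>Computability in exponential time\<close>

text \<open>Deterministic multitape Turing machines over an input alphabet \<open>'a\<close>. Tapes are infinite in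
  both directions; tape 0 holds the input and tape 1 the output, each starting in cell 0. The
  machine halts when no transition applies. Finiteness of the transition table bounds the number of
  states and of auxiliary tape symbols.\<close>

datatype 'a symbol = Blank | Letter 'a | Aux nat

datatype move = MoveLeft | Stay | MoveRight

record 'a tm =
  num_tapes :: nat
  trans :: "nat \<times> 'a symbol list \<Rightarrow> (nat \<times> ('a symbol \<times> move) list) option"

definition is_tm :: "'a tm \<Rightarrow> bool" where
  "is_tm M \<longleftrightarrow> num_tapes M \<ge> 2 \<and> finite (dom (trans M)) \<and>
     (\<forall>q ss q' as. trans M (q, ss) = Some (q', as) \<longrightarrow>
        length ss = num_tapes M \<and> length as = num_tapes M)"

text \<open>A tape is given by the position of its head and its contents.\<close>

type_synonym 'a tape = "int \<times> (int \<Rightarrow> 'a symbol)"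

type_synonym 'a config = "nat \<times> 'a tape list"

fun read :: "'a tape \<Rightarrow> 'a symbol" where
  "read (h, T) = T h"

fun offset :: "move \<Rightarrow> int" where
  "offset MoveLeft = -1"
| "offset Stay = 0"
| "offset MoveRight = 1"

fun act :: "'a symbol \<times> move \<Rightarrow> 'a tape \<Rightarrow> 'a tape" where
  "act (s, m) (h, T) = (h + offset m, T(h := s))"

fun halted :: "'a tm \<Rightarrow> 'a config \<Rightarrow> bool" where
  "halted M (q, ts) \<longleftrightarrow> trans M (q, map read ts) = None"

fun step :: "'a tm \<Rightarrow> 'a config \<Rightarrow> 'a config" where
  "step M (q, ts) = (case trans M (q, map read ts) of
      None \<Rightarrow> (q, ts)
    | Some (q', as) \<Rightarrow> (q', map2 act as ts))"

definition word_contents :: "'a list \<Rightarrow> int \<Rightarrow> 'a symbol" where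
  "word_contents w i = (if 0 \<le> i \<and> i < int (length w) then Letter (w ! nat i) else Blank)"

definition init_config :: "'a tm \<Rightarrow> 'a list \<Rightarrow> 'a config" where
  "init_config M w = (0, (0, word_contents w) # replicate (num_tapes M - 1) (0, word_contents []))"

definition outputs_within :: "'a tm \<Rightarrow> 'a list \<Rightarrow> 'a list \<Rightarrow> nat \<Rightarrow> bool" where
  "outputs_within M v w n \<longleftrightarrow>
     (let c = (step M ^^ n) (init_config M v)
      in halted M c \<and> snd (snd c ! 1) = word_contents w)"

text \<open>Partial functions are handled by restricting the arguments to a set \<open>A\<close>, on which alone the
  behaviour of the machine is prescribed. Exponential means \<open>2\<close> to a polynomial in the length of the
  input word.\<close>

definition exp_time_computable_on ::
    "'x set \<Rightarrow> ('x \<Rightarrow> 'a::finite list) \<Rightarrow> ('y \<Rightarrow> 'a list) \<Rightarrow> ('x \<Rightarrow> 'y) \<Rightarrow> bool" where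
  "exp_time_computable_on A enc_in enc_out f \<longleftrightarrow>
     (\<exists>M (p :: nat poly). is_tm M \<and>
        (\<forall>x\<in>A. outputs_within M (enc_in x) (enc_out (f x)) (2 ^ poly p (length (enc_in x)))))"

end

theory Submission
  imports Defs
begin

text \<open>For an interval order the sets \<open>{z. x \<succ> z}\<close> are linearly ordered by inclusion, so their strict
  inclusion is a weak order, and it extends \<open>\<succ>\<close> because \<open>y\<close> belongs to the set of \<open>x\<close> but
  not to its own when \<open>x \<succ> y\<close>. It is defined by \<open>\<exists>z. C(x, z) \<and> \<not> C(y, z)\<close>. Word for word, this
  formula is the concatenation of three finite-state translations of \<open>C\<close>, namely the quantifier
  prefix and the two instances of \<open>C\<close>; hence a machine that reads its input three times
  produces it, even in linear time.\<close>

section \<open>Weak order extensions of interval orders\<close>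

text \<open>Negative transitivity is transitivity of inclusion between successor sets. Transitivity
  uses the interval order condition: given a successor \<open>a\<close> of \<open>x\<close> but not
  of \<open>y\<close>, and a successor \<open>b\<close> of \<open>y\<close> but not of
  \<open>z\<close>, one of \<open>(x, b)\<close> and \<open>(y, a)\<close> lies in \<open>r\<close>,
  hence the former.\<close>

lemma weak_order_on_interval_order:
  assumes "interval_order_on U r"
  shows "weak_order_on U {(x, y) \<in> U \<times> U. \<exists>z\<in>U. (x, z) \<in> r \<and> (y, z) \<notin> r}"
  using assms unfolding interval_order_on_def weak_order_on_def irrefl_on_def trans_on_def
  by blast

lemma interval_order_subset_extension:
  assumes "interval_order_on U r"
  shows "r \<subseteq> {(x, y) \<in> U \<times> U. \<exists>z\<in>U. (x, z) \<in> r \<and> (y, z) \<notin> r}"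
  using assms unfolding interval_order_on_def irrefl_on_def by blast

section \<open>The formula defining the extension\<close>

text \<open>The attribute with index \<open>i\<close> of the quantified tuple \<open>z\<close> becomes \<open>Bnd s (z_index i)\<close>,
  and the bound variables of the given formula are moved out of the way. The sort \<open>s\<close> is the one
  of the surrounding atom, so that no schema is needed. In binary, both renamings prepend two fixed
  bits.\<close>

definition z_index :: "nat \<Rightarrow> nat" where
  "z_index i = 4 * i + 2"

definition bnd_index :: "nat \<Rightarrow> nat" where
  "bnd_index n = 4 * n + 3"

lemma index_simps [simp]:
  "bnd_index m = bnd_index n \<longleftrightarrow> m = n"
  "z_index i \<noteq> bnd_index n" "bnd_index n \<noteq> z_index i"
  "z_index i div 4 = i"
  unfolding z_index_def bnd_index_def by presburger+

text \<open>The choice \<open>h = Fst\<close> yields C(x, z), and \<open>h = Snd\<close> yields C(y,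
  z).\<close>

fun inst_var :: "(nat \<Rightarrow> var) \<Rightarrow> sort \<Rightarrow> var \<Rightarrow> var" where
  "inst_var h s (Fst i) = h i"
| "inst_var h s (Snd i) = Bnd s (z_index i)"
| "inst_var h s (Bnd s' n) = Bnd s' (bnd_index n)"

fun inst_rhs :: "(nat \<Rightarrow> var) \<Rightarrow> sort \<Rightarrow> 'c rhs \<Rightarrow> 'c rhs" where
  "inst_rhs h s (Var x) = Var (inst_var h s x)"
| "inst_rhs h s (Cst c) = Cst c"

fun inst_fm :: "(nat \<Rightarrow> var) \<Rightarrow> 'd fm \<Rightarrow> 'd fm" where
  "inst_fm h (DAtom r x u) = DAtom r (inst_var h DSort x) (inst_rhs h DSort u)"
| "inst_fm h (QAtom r x u) = QAtom r (inst_var h QSort x) (inst_rhs h QSort u)"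
| "inst_fm h (Neg \<phi>) = Neg (inst_fm h \<phi>)"
| "inst_fm h (Conj \<phi> \<psi>) = Conj (inst_fm h \<phi>) (inst_fm h \<psi>)"
| "inst_fm h (Disj \<phi> \<psi>) = Disj (inst_fm h \<phi>) (inst_fm h \<psi>)"
| "inst_fm h (Impl \<phi> \<psi>) = Impl (inst_fm h \<phi>) (inst_fm h \<psi>)"
| "inst_fm h (Ex s n \<phi>) = Ex s (bnd_index n) (inst_fm h \<phi>)"
| "inst_fm h (All s n \<phi>) = All s (bnd_index n) (inst_fm h \<phi>)"

text \<open>Only the attributes of z that occur in the formula are quantified. Order of occurrence
  and repetitions are kept, so that one left-to-right pass over the word can emit the
  quantifiers.\<close>

fun snd_var :: "sort \<Rightarrow> var \<Rightarrow> (sort \<times> nat) list" where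
  "snd_var s (Snd i) = [(s, i)]"
| "snd_var s x = []"

fun snd_rhs :: "sort \<Rightarrow> 'c rhs \<Rightarrow> (sort \<times> nat) list" where
  "snd_rhs s (Var x) = snd_var s x"
| "snd_rhs s (Cst c) = []"

fun snd_fm :: "'d fm \<Rightarrow> (sort \<times> nat) list" where
  "snd_fm (DAtom r x u) = snd_var DSort x @ snd_rhs DSort u"
| "snd_fm (QAtom r x u) = snd_var QSort x @ snd_rhs QSort u"
| "snd_fm (Neg \<phi>) = snd_fm \<phi>"
| "snd_fm (Conj \<phi> \<psi>) = snd_fm \<phi> @ snd_fm \<psi>"
| "snd_fm (Disj \<phi> \<psi>) = snd_fm \<phi> @ snd_fm \<psi>"
| "snd_fm (Impl \<phi> \<psi>) = snd_fm \<phi> @ snd_fm \<psi>"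
| "snd_fm (Ex s n \<phi>) = snd_fm \<phi>"
| "snd_fm (All s n \<phi>) = snd_fm \<phi>"

definition ex_snd :: "(sort \<times> nat) list \<Rightarrow> 'd fm \<Rightarrow> 'd fm" where
  "ex_snd xs \<phi> = foldr (\<lambda>(s, i). Ex s (z_index i)) xs \<phi>"

definition ext_fm :: "'d fm \<Rightarrow> 'd fm" where
  "ext_fm C = ex_snd (snd_fm C) (Conj (inst_fm Fst C) (Neg (inst_fm Snd C)))"

lemma ex_snd_simps [simp]:
  "ex_snd [] \<phi> = \<phi>"
  "ex_snd ((s, i) # xs) \<phi> = Ex s (z_index i) (ex_snd xs \<phi>)"
  by (simp_all add: ex_snd_def)

section \<open>Semantics of the extension formula\<close>

lemma snd_var_sorted:
  "(s', i) \<in> set (snd_var s x) \<Longrightarrow> var_sorted R s x \<Longrightarrow> i < length R \<and> R ! i = s'"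
  by (cases x) auto

lemma snd_fm_sorted:
  "(s, i) \<in> set (snd_fm C) \<Longrightarrow> well_sorted R C \<Longrightarrow> i < length R \<and> R ! i = s"
proof (induction C)
  case (DAtom r x u)
  then show ?case by (cases u) (auto dest: snd_var_sorted)
next
  case (QAtom r x u)
  then show ?case by (cases u) (auto dest: snd_var_sorted)
qed auto

lemma inst_var_eq:
  assumes "\<And>i. e' (h i) = e (Fst i)"
    and "\<And>s' i. (s', i) \<in> set (snd_var s x) \<Longrightarrow> e' (Bnd s' (z_index i)) = e (Snd i)"
    and "\<And>s n. e' (Bnd s (bnd_index n)) = e (Bnd s n)"
  shows "e' (inst_var h s x) = e x"
  using assms by (cases x) auto

lemma inst_rhs_eq:
  assumes "\<And>i. e' (h i) = e (Fst i)"
    and "\<And>s' i. (s', i) \<in> set (snd_rhs s u) \<Longrightarrow> e' (Bnd s' (z_index i)) = e (Snd i)"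
    and "\<And>s n. e' (Bnd s (bnd_index n)) = e (Bnd s n)"
  shows "rhs_val mk e' (inst_rhs h s u) = rhs_val mk e u"
  using assms by (cases u) (auto intro: inst_var_eq)

text \<open>The environments stay arbitrary in the induction because quantifiers update auxiliary
  variables. The assumption on \<open>h\<close> and the disjointness of the two index families
  ensure that such an update leaves the values standing for both tuples untouched.\<close>

lemma holds_inst_fm:
  assumes h: "\<And>i s n. h i \<noteq> Bnd s n"
  shows "\<lbrakk>\<And>i. e' (h i) = e (Fst i);
    \<And>s i. (s, i) \<in> set (snd_fm C) \<Longrightarrow> e' (Bnd s (z_index i)) = e (Snd i);
    \<And>s n. e' (Bnd s (bnd_index n)) = e (Bnd s n)\<rbrakk> \<Longrightarrow> holds e' (inst_fm h C) = holds e C"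
proof (induction C arbitrary: e e')
  case (DAtom r x u)
  then show ?case by (auto simp: inst_var_eq[of e' h e] inst_rhs_eq[of e' h e])
next
  case (QAtom r x u)
  then show ?case by (auto simp: inst_var_eq[of e' h e] inst_rhs_eq[of e' h e])
next
  case (Ex s n C)
  have "holds (e'(Bnd s (bnd_index n) := v)) (inst_fm h C) = holds (e(Bnd s n := v)) C" for v
    using h by (intro Ex.IH) (auto simp: Ex.prems)
  then show ?case by simp
next
  case (All s n C)
  have "holds (e'(Bnd s (bnd_index n) := v)) (inst_fm h C) = holds (e(Bnd s n := v)) C" for v
    using h by (intro All.IH) (auto simp: All.prems)
  then show ?case by simp
next
  case (Neg C)
  then show ?case using Neg.IH[of e' e] by simp
next
  case (Conj C D)
  then show ?case using Conj.IH[of e' e] by simp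
next
  case (Disj C D)
  then show ?case using Disj.IH[of e' e] by simp
next
  case (Impl C D)
  then show ?case using Impl.IH[of e' e] by simp
qed

text \<open>Repetitions in \<open>xs\<close> do no harm: for a variable quantified twice the inner
  choice overrides the outer one, and both range over the same sort, since the sort is part of the
  variable.\<close>

lemma holds_ex_snd:
  "holds e (ex_snd xs \<phi>) \<longleftrightarrow>
    (\<exists>e'. (\<forall>(s, i)\<in>set xs. sort_of (e' (Bnd s (z_index i))) = s) \<and>
      (\<forall>x. x \<notin> (\<lambda>(s, i). Bnd s (z_index i)) ` set xs \<longrightarrow> e' x = e x) \<and> holds e' \<phi>)"
proof (induction xs arbitrary: e)
  case Nil
  have "e' = e" if "\<forall>x. e' x = e x" for e' using that by auto
  then show ?case by auto
next
  case (Cons a xs)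
  obtain s i where a: "a = (s, i)" by fastforce
  let ?x = "Bnd s (z_index i)"
  show ?case (is "_ = (\<exists>e'. ?P e')")
  proof
    assume "holds e (ex_snd (a # xs) \<phi>)"
    then obtain v e' where v: "sort_of v = s" and
      e': "\<forall>(s, i)\<in>set xs. sort_of (e' (Bnd s (z_index i))) = s"
        "\<forall>x. x \<notin> (\<lambda>(s, i). Bnd s (z_index i)) ` set xs \<longrightarrow> e' x = (e(?x := v)) x" "holds e' \<phi>"
      unfolding a by (auto simp: Cons.IH)
    have "sort_of (e' ?x) = s"
    proof (cases "?x \<in> (\<lambda>(s, i). Bnd s (z_index i)) ` set xs")
      case True
      then show ?thesis using e'(1) by auto
    next
      case False
      then show ?thesis using e'(2) v by simp
    qed
    then have "?P e'" using e' by (auto simp: a)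
    then show "\<exists>e'. ?P e'" by blast
  next
    assume "\<exists>e'. ?P e'"
    then obtain e' where e': "?P e'" by blast
    \<comment> \<open>The outermost quantifier receives the final value \<open>e' ?x\<close>, so
      that \<open>e'\<close> itself serves as witness for the remaining ones.\<close>
    then have "holds (e(?x := e' ?x)) (ex_snd xs \<phi>)"
      unfolding Cons.IH by (intro exI[of _ e']) (auto simp: a)
    moreover have "sort_of (e' ?x) = s" using e' by (simp add: a)
    ultimately show "holds e (ex_snd (a # xs) \<phi>)" by (auto simp: a)
  qed
qed

lemma holds_ext_fm:
  fixes C :: "'d fm"
  assumes "well_sorted R C"
  shows "holds (tuple_env t1 t2) (ext_fm C) \<longleftrightarrow>
    (\<exists>z\<in>tuples R. holds (tuple_env t1 z) C \<and> \<not> holds (tuple_env t2 z) C)"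
proof
  assume "holds (tuple_env t1 t2) (ext_fm C)"
  then obtain e' :: "var \<Rightarrow> 'd val" where
    srt: "\<And>s i. (s, i) \<in> set (snd_fm C) \<Longrightarrow> sort_of (e' (Bnd s (z_index i))) = s" and
    eq: "\<And>x. x \<notin> (\<lambda>(s, i). Bnd s (z_index i)) ` set (snd_fm C) \<Longrightarrow> e' x = tuple_env t1 t2 x" and
    hl: "holds e' (inst_fm Fst C)" "\<not> holds e' (inst_fm Snd C)"
    unfolding ext_fm_def holds_ex_snd by auto
  \<comment> \<open>The formula says nothing about attributes of z that it does not mention;
    defaults of the right sort turn \<open>z\<close> into a tuple of the schema.\<close>
  define dflt :: "sort \<Rightarrow> 'd val" where
    "dflt s = (case s of DSort \<Rightarrow> DVal undefined | QSort \<Rightarrow> QVal 0)" for s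
  define z where "z = map (\<lambda>i. if (R ! i, i) \<in> set (snd_fm C) then e' (Bnd (R ! i) (z_index i))
    else dflt (R ! i)) [0..<length R]"
  have "sort_of (dflt s) = s" for s by (cases s) (auto simp: dflt_def)
  then have z: "z \<in> tuples R"
    unfolding z_def tuples_def by (auto intro!: nth_equalityI simp: srt)
  have zi: "z ! i = e' (Bnd s (z_index i))" if "(s, i) \<in> set (snd_fm C)" for s i
    using snd_fm_sorted[OF that assms] that by (auto simp: z_def)
  \<comment> \<open>Such a variable is never among the quantified ones, so it keeps its value under
    \<open>tuple_env\<close>, which is \<open>undefined\<close> whatever the tuples are.\<close>
  have bnd: "e' (Bnd s (bnd_index n)) = undefined" for s n
    by (subst eq) auto
  have fs: "e' (Fst i) = t1 ! i" "e' (Snd i) = t2 ! i" for i by (subst eq; auto)+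
  have "holds e' (inst_fm Fst C) = holds (tuple_env t1 z) C"
    by (rule holds_inst_fm) (auto simp: bnd zi fs)
  moreover have "holds e' (inst_fm Snd C) = holds (tuple_env t2 z) C"
    by (rule holds_inst_fm) (auto simp: bnd zi fs)
  ultimately show "\<exists>z\<in>tuples R. holds (tuple_env t1 z) C \<and> \<not> holds (tuple_env t2 z) C"
    using z hl by blast
next
  assume "\<exists>z\<in>tuples R. holds (tuple_env t1 z) C \<and> \<not> holds (tuple_env t2 z) C"
  then obtain z where z: "z \<in> tuples R" "holds (tuple_env t1 z) C" "\<not> holds (tuple_env t2 z) C"
    by blast
  define X where "X = (\<lambda>(s, i). Bnd s (z_index i)) ` set (snd_fm C)"
  \<comment> \<open>Conversely, the quantified variables take the components of \<open>z\<close>;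
    division by 4 inverts \<open>z_index\<close>.\<close>
  define e' where "e' x = (if x \<in> X then case x of Bnd s m \<Rightarrow> z ! (m div 4) | _ \<Rightarrow> undefined
    else tuple_env t1 t2 x)" for x
  have zi: "e' (Bnd s (z_index i)) = z ! i" if "(s, i) \<in> set (snd_fm C)" for s i
    using that by (force simp: e'_def X_def)
  have srt: "sort_of (z ! i) = s" if "(s, i) \<in> set (snd_fm C)" for s i
    using snd_fm_sorted[OF that assms] z(1) by (auto simp: tuples_def)
  have bnd: "e' (Bnd s (bnd_index n)) = undefined" for s n
    by (auto simp: e'_def X_def)
  have fs: "e' (Fst i) = t1 ! i" "e' (Snd i) = t2 ! i" for i by (auto simp: e'_def X_def)
  have "holds e' (inst_fm Fst C) = holds (tuple_env t1 z) C"
    by (rule holds_inst_fm) (auto simp: bnd zi fs)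
  moreover have "holds e' (inst_fm Snd C) = holds (tuple_env t2 z) C"
    by (rule holds_inst_fm) (auto simp: bnd zi fs)
  ultimately have "holds e' (Conj (inst_fm Fst C) (Neg (inst_fm Snd C)))" using z by simp
  then show "holds (tuple_env t1 t2) (ext_fm C)"
    unfolding ext_fm_def holds_ex_snd X_def[symmetric]
    by (intro exI[of _ e']) (auto simp: zi srt, simp add: e'_def)
qed

section \<open>Sorts and free variables of the extension formula\<close>

lemma var_sorted_inst_var:
  "var_sorted R s x \<Longrightarrow> h = Fst \<or> h = Snd \<Longrightarrow> var_sorted R s (inst_var h s x)"
  by (cases x) auto

lemma well_sorted_inst_fm:
  "well_sorted R C \<Longrightarrow> h = Fst \<or> h = Snd \<Longrightarrow> well_sorted R (inst_fm h C)"
proof (induction C)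
  case (DAtom r x u)
  then show ?case by (cases u) (auto simp: var_sorted_inst_var)
next
  case (QAtom r x u)
  then show ?case by (cases u) (auto simp: var_sorted_inst_var)
qed auto

lemma inst_var_cases:
  "inst_var h s x \<in> range h \<or> (\<exists>(s', i)\<in>set (snd_var s x). inst_var h s x = Bnd s' (z_index i)) \<or>
    (\<exists>s' n. x = Bnd s' n \<and> inst_var h s x = Bnd s' (bnd_index n))"
  by (cases x) auto

text \<open>The last alternative carries the induction through quantifiers, whose bodies may have
  free auxiliary variables. It is void for an ERO formula.\<close>

lemma free_vars_inst_fm:
  fixes C :: "'d fm"
  shows "x \<in> free_vars (inst_fm h C) \<Longrightarrow> x \<in> range h \<or>
    (\<exists>(s, i)\<in>set (snd_fm C). x = Bnd s (z_index i)) \<or>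
    (\<exists>s n. Bnd s n \<in> free_vars C \<and> x = Bnd s (bnd_index n))"
proof (induction C)
  case (DAtom r y u)
  then obtain v where "x = inst_var h DSort v" "v \<in> free_vars (DAtom r y u)"
    "set (snd_var DSort v) \<subseteq> set (snd_fm (DAtom r y u))"
    by (cases u) auto
  then show ?case using inst_var_cases[of h DSort v] by blast
next
  case (QAtom r y u)
  then obtain v where "x = inst_var h QSort v" "v \<in> free_vars (QAtom r y u :: 'd fm)"
    "set (snd_var QSort v) \<subseteq> set (snd_fm (QAtom r y u :: 'd fm))"
    by (cases u) auto
  then show ?case using inst_var_cases[of h QSort v] by blast
next
  case (Conj C D)
  then show ?case unfolding inst_fm.simps free_vars.simps snd_fm.simps set_append by blast
next
  case (Disj C D)
  then show ?case unfolding inst_fm.simps free_vars.simps snd_fm.simps set_append by blast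
next
  case (Impl C D)
  then show ?case unfolding inst_fm.simps free_vars.simps snd_fm.simps set_append by blast
qed auto

lemma well_sorted_ex_snd: "well_sorted R (ex_snd xs \<phi>) = well_sorted R \<phi>"
  by (induction xs) (auto simp: ex_snd_def)

lemma free_vars_ex_snd:
  "free_vars (ex_snd xs \<phi>) = free_vars \<phi> - (\<lambda>(s, i). Bnd s (z_index i)) ` set xs"
  by (induction xs) (auto simp: ex_snd_def)

lemma ERO_ext_fm:
  assumes "ERO R C"
  shows "ERO R (ext_fm C)"
proof -
  have "Bnd s n \<notin> free_vars C" for s n using assms by (auto simp: ERO_def)
  then have "free_vars (inst_fm h C) \<subseteq> range h \<union> (\<lambda>(s, i). Bnd s (z_index i)) ` set (snd_fm C)" for h
    using free_vars_inst_fm[of _ h C] by fastforce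
  from this[of Fst] this[of Snd] show ?thesis
    using assms
    by (auto simp: ERO_def ext_fm_def well_sorted_ex_snd well_sorted_inst_fm free_vars_ex_snd)
qed

lemma pref_ext_fm:
  assumes "ERO R C"
  shows "pref R (ext_fm C) = {(x, y) \<in> tuples R \<times> tuples R.
    \<exists>z\<in>tuples R. (x, z) \<in> pref R C \<and> (y, z) \<notin> pref R C}"
  using assms holds_ext_fm[of R C] by (auto simp: ERO_def pref_def)

section \<open>Finite-state translations in several passes\<close>

fun run :: "('s \<Rightarrow> 'a \<Rightarrow> 's \<times> 'a list) \<Rightarrow> 's \<Rightarrow> 'a list \<Rightarrow> 's \<times> 'a list" where
  "run \<delta> s [] = (s, [])"
| "run \<delta> s (a # w) = (let (s', u) = \<delta> s a; (s'', v) = run \<delta> s' w in (s'', u @ v))"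

lemma run_append:
  "run \<delta> s v = (s', x) \<Longrightarrow> run \<delta> s' w = (s'', y) \<Longrightarrow> run \<delta> s (v @ w) = (s'', x @ y)"
  by (induction v arbitrary: s x) (auto split: prod.splits)

text \<open>The first component is written before reading starts. It provides tokens that stem from
  no input token, such as the connectives joining the two instances of the formula.\<close>

type_synonym ('s, 'a) pass = "'a list \<times> 's \<times> ('s \<Rightarrow> 'a \<Rightarrow> 's \<times> 'a list)"

fun pass_output :: "('s, 'a) pass \<Rightarrow> 'a list \<Rightarrow> 'a list" where
  "pass_output (u, s, \<delta>) w = u @ snd (run \<delta> s w)"

section \<open>Turing machines for multi-pass translations\<close>

lemma word_contents_snoc:
  "(word_contents w)(int (length w) := Letter a) = word_contents (w @ [a])"
  by (rule ext) (auto simp: word_contents_def nth_append)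

fun letter_of :: "'a symbol \<Rightarrow> 'a option" where
  "letter_of (Letter a) = Some a"
| "letter_of _ = None"

text \<open>A two-way transducer that emits a word in each step becomes a machine that keeps the part of
  this word not yet written in its state.\<close>

lemma two_way_transducer_tm:
  fixes D :: "'q \<Rightarrow> 'a::finite option \<Rightarrow> ('q \<times> 'a list \<times> move) option"
  assumes "finite Q" "q0 \<in> Q"
    and closed: "\<And>q a q' u m. q \<in> Q \<Longrightarrow> D q a = Some (q', u, m) \<Longrightarrow> q' \<in> Q"
    and len: "\<And>q a q' u m. q \<in> Q \<Longrightarrow> D q a = Some (q', u, m) \<Longrightarrow> length u \<le> K"
  obtains M :: "'a tm" and conf :: "'a list \<Rightarrow> 'q \<Rightarrow> int \<Rightarrow> 'a list \<Rightarrow> 'a config" where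
    "is_tm M"
    "\<And>w. init_config M w = conf w q0 0 []"
    "\<And>w q i out. snd (snd (conf w q i out) ! 1) = word_contents out"
    "\<And>w q i out. q \<in> Q \<Longrightarrow> D q (letter_of (word_contents w i)) = None \<Longrightarrow> halted M (conf w q i out)"
    "\<And>w q i out q' u m. q \<in> Q \<Longrightarrow> D q (letter_of (word_contents w i)) = Some (q', u, m) \<Longrightarrow>
      (step M ^^ Suc (length u)) (conf w q i out) = conf w q' (i + offset m) (out @ u)"
proof -
  \<comment> \<open>The bound \<open>K\<close> keeps the set of states with pending output
    finite.\<close>
  define S where "S = Q \<times> {u :: 'a list. set u \<subseteq> UNIV \<and> length u \<le> K}"
  have fS: "finite S" unfolding S_def
    using \<open>finite Q\<close> by (intro finite_cartesian_product finite_lists_length_le) auto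
  obtain g :: "'q \<times> 'a list \<Rightarrow> nat" where g: "inj_on g S"
    using finite_imp_inj_to_nat_seg[OF fS] by blast
  \<comment> \<open>A machine starts in state 0, so the initial state is coded by 0 and the other
    codes are shifted.\<close>
  define f where "f st = (if st = (q0, []) then 0 else Suc (g st))" for st
  have f: "inj_on f S" using g by (auto simp: f_def inj_on_def)
  define ctl :: "'q \<times> 'a list \<Rightarrow> 'a symbol \<Rightarrow> (nat \<times> ('a symbol \<times> move) list) option" where
    "ctl = (\<lambda>(q, u) a. case u of
        b # u' \<Rightarrow> Some (f (q, u'), [(a, Stay), (Letter b, MoveRight)])
      | [] \<Rightarrow> map_option (\<lambda>(q', u', m). (f (q', u'), [(a, m), (Blank, Stay)])) (D q (letter_of a)))"
  define \<Sigma> :: "'a symbol set" where "\<Sigma> = insert Blank (range Letter)"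
  \<comment> \<open>The input tape never changes, and the output head rests on the first blank cell
    after the output. Hence only pairs \<open>[a, Blank]\<close> with \<open>a\<close> in
    \<open>\<Sigma>\<close> are ever read, and the table is finite.\<close>
  define M :: "'a tm" where "M = \<lparr>num_tapes = 2, trans = (\<lambda>(n, ss).
    if n \<in> f ` S \<and> ss \<in> (\<lambda>a. [a, Blank]) ` \<Sigma> then ctl (the_inv_into S f n) (hd ss) else None)\<rparr>"
  define full :: "'a list \<Rightarrow> 'q \<times> 'a list \<Rightarrow> int \<Rightarrow> 'a list \<Rightarrow> 'a config" where
    "full w st i out = (f st, [(i, word_contents w), (int (length out), word_contents out)])"
    for w st i out
  have tr: "trans M (f st, map read (snd (full w st i out))) = ctl st (word_contents w i)"
    if "st \<in> S" for w st i out
    using that f by (auto simp: M_def full_def word_contents_def \<Sigma>_def the_inv_into_f_f)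
  have fst_full: "full w st i out = (f st, snd (full w st i out))" for w st i out
    by (simp add: full_def)
  have write1: "step M (full w (q, b # u) i out) = full w (q, u) i (out @ [b])"
    if "(q, b # u) \<in> S" for w q b u i out
  proof -
    have "trans M (f (q, b # u), map read (snd (full w (q, b # u) i out))) =
      Some (f (q, u), [(word_contents w i, Stay), (Letter b, MoveRight)])"
      using tr[OF that, of w i out] by (simp add: ctl_def)
    then show ?thesis by (simp add: full_def word_contents_snoc)
  qed
  have writes: "(step M ^^ length u) (full w (q, u) i out) = full w (q, []) i (out @ u)"
    if "(q, u) \<in> S" for w q u i out
    using that
  proof (induction u arbitrary: out)
    case (Cons b u)
    have "(q, u) \<in> S" using Cons.prems by (auto simp: S_def)
    then show ?case using Cons.IH write1[OF Cons.prems]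
      by (simp add: funpow_Suc_right del: funpow.simps(2))
  qed simp
  have inS: "(q, []) \<in> S" if "q \<in> Q" for q using that by (simp add: S_def)
  have blank: "(word_contents out)(int (length out) := Blank) = word_contents out" for out :: "'a list"
    by (rule ext) (auto simp: word_contents_def)
  have consume: "step M (full w (q, []) i out) = full w (q', u) (i + offset m) out"
    if "q \<in> Q" "D q (letter_of (word_contents w i)) = Some (q', u, m)" for w q i out q' u m
  proof -
    have "trans M (f (q, []), map read (snd (full w (q, []) i out))) =
      Some (f (q', u), [(word_contents w i, m), (Blank, Stay)])"
      using tr[OF inS[OF that(1)], of w i out] that(2) by (simp add: ctl_def)
    then show ?thesis by (simp add: full_def blank)
  qed
  show thesis
  proof (rule that[of M "\<lambda>w q. full w (q, [])"])
    have "dom (trans M) \<subseteq> f ` S \<times> (\<lambda>a. [a, Blank]) ` \<Sigma>"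
      by (auto simp: M_def split: if_splits)
    moreover have "finite (f ` S \<times> (\<lambda>a. [a, Blank]) ` \<Sigma>)" using fS by (auto simp: \<Sigma>_def)
    ultimately have "finite (dom (trans M))" by (rule finite_subset)
    moreover have "length as = 2" if "ctl st a = Some (n, as)" for st a n as
      using that by (cases st) (auto simp: ctl_def split: list.splits)
    ultimately show "is_tm M"
      by (auto simp: is_tm_def M_def split: if_splits)
    show "init_config M w = full w (q0, []) 0 []" for w
      by (simp add: init_config_def M_def full_def f_def)
    show "snd (snd (full w (q, []) i out) ! 1) = word_contents out" for w q i out
      by (simp add: full_def)
    show "halted M (full w (q, []) i out)"
      if "q \<in> Q" "D q (letter_of (word_contents w i)) = None" for w q i out
      using tr[OF inS[OF that(1)], of w i out] that(2) by (subst fst_full) (simp add: ctl_def)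
    show "(step M ^^ Suc (length u)) (full w (q, []) i out) = full w (q', []) (i + offset m) (out @ u)"
      if "q \<in> Q" "D q (letter_of (word_contents w i)) = Some (q', u, m)" for w q i out q' u m
    proof -
      have "(q', u) \<in> S" using closed[OF that] len[OF that] by (simp add: S_def)
      then show ?thesis using consume[OF that] writes
        by (simp add: funpow_Suc_right del: funpow.simps(2))
    qed
  qed
qed

lemma halted_funpow:
  assumes "halted M c"
  shows "(step M ^^ n) c = c"
proof -
  have "step M c = c" using assms by (cases c) simp
  then show ?thesis by (induction n) auto
qed

lemma outputs_within_mono:
  assumes "outputs_within M v w m" "m \<le> n"
  shows "outputs_within M v w n"
proof -
  have "(step M ^^ n) c = (step M ^^ (n - m)) ((step M ^^ m) c)" for c
    using assms(2) by (metis funpow_add comp_apply le_add_diff_inverse2)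
  then show ?thesis using assms(1) by (simp add: outputs_within_def Let_def halted_funpow)
qed

text \<open>The state \<open>(p, None)\<close> returns to the beginning of the input before pass \<open>p\<close>, and \<open>(p, Some s)\<close>
  performs this pass.\<close>

fun passes_control :: "('s, 'a) pass list \<Rightarrow> nat \<times> 's option \<Rightarrow> 'a option \<Rightarrow>
    ((nat \<times> 's option) \<times> 'a list \<times> move) option" where
  "passes_control ps (p, t) a = (if p < length ps then
    (case ps ! p of (u, s0, \<delta>) \<Rightarrow> (case (t, a) of
        (None, None) \<Rightarrow> Some ((p, Some s0), u, MoveRight)
      | (None, Some b) \<Rightarrow> Some ((p, None), [], MoveLeft)
      | (Some s, None) \<Rightarrow> Some ((Suc p, None), [], MoveLeft)
      | (Some s, Some b) \<Rightarrow> (case \<delta> s b of (s', v) \<Rightarrow> Some ((p, Some s'), v, MoveRight))))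
    else None)"

text \<open>Before each pass the head returns to the blank left of the input, so a pass takes
  linearly many control moves. Each of them costs boundedly many machine steps, because the emitted
  words have bounded length.\<close>

lemma passes_tm:
  fixes ps :: "('s::finite, 'a::finite) pass list"
  obtains M :: "'a tm" and c where "is_tm M"
    "\<And>w. w \<noteq> [] \<Longrightarrow>
      outputs_within M w (concat (map (\<lambda>p. pass_output p w) ps)) (c * (length w + 1))"
proof -
  define Q :: "(nat \<times> 's option) set" where "Q = {..length ps} \<times> UNIV"
  define D where "D = passes_control ps"
  have "finite Q" by (simp add: Q_def)
  have q0: "(0, None) \<in> Q" by (simp add: Q_def)
  have closed: "q' \<in> Q" if "q \<in> Q" "D q a = Some (q', u, m)" for q a q' u m
    using that by (cases q) (auto simp: Q_def D_def split: if_splits prod.splits option.splits)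
  define L where "L = (\<lambda>(q, a). case D q a of Some (q', u, m) \<Rightarrow> length u | None \<Rightarrow> 0) ` (Q \<times> UNIV)"
  define K where "K = Max L"
  have "finite L" using \<open>finite Q\<close> by (simp add: L_def)
  have len: "length u \<le> K" if "q \<in> Q" "D q a = Some (q', u, m)" for q a q' u m
  proof -
    have "length u \<in> L" using that unfolding L_def by (intro image_eqI[of _ _ "(q, a)"]) auto
    then show ?thesis using \<open>finite L\<close> by (simp add: K_def)
  qed
  obtain M :: "'a tm" and conf where M: "is_tm M"
    and init: "\<And>w. init_config M w = conf w (0, None) 0 []"
    and out: "\<And>w q i out. snd (snd (conf w q i out) ! 1) = word_contents out"
    and halt: "\<And>w q i out. q \<in> Q \<Longrightarrow> D q (letter_of (word_contents w i)) = None \<Longrightarrow>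
      halted M (conf w q i out)"
    and stp: "\<And>w q i out q' u m. q \<in> Q \<Longrightarrow> D q (letter_of (word_contents w i)) = Some (q', u, m) \<Longrightarrow>
      (step M ^^ Suc (length u)) (conf w q i out) = conf w q' (i + offset m) (out @ u)"
    using two_way_transducer_tm[OF \<open>finite Q\<close> q0, of D K] closed len by blast
  \<comment> \<open>The index counts control moves, each of which takes one step to read and at most
    \<open>K\<close> steps to write.\<close>
  define reach where "reach n c c' \<longleftrightarrow> (\<exists>m \<le> n * Suc K. (step M ^^ m) c = c')" for n c c'
  have refl: "reach 0 c c" for c by (simp add: reach_def)
  have trans: "reach (m + n) c c''" if "reach m c c'" "reach n c' c''" for m n c c' c''
  proof -
    from that obtain a b where "a \<le> m * Suc K" "(step M ^^ a) c = c'" "b \<le> n * Suc K"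
      "(step M ^^ b) c' = c''" by (auto simp: reach_def)
    moreover from this have "(step M ^^ (b + a)) c = c''" by (simp add: funpow_add)
    ultimately have "b + a \<le> (m + n) * Suc K" "(step M ^^ (b + a)) c = c''"
      by (simp_all add: algebra_simps)
    then show ?thesis unfolding reach_def by blast
  qed
  have stp1: "reach 1 (conf w q i out) (conf w q' (i + offset m) (out @ u))"
    if "q \<in> Q" "D q (letter_of (word_contents w i)) = Some (q', u, m)" for w q i out q' u m
    using stp[OF that, of out] len[OF that] unfolding reach_def
    by (intro exI[of _ "Suc (length u)"]) simp
  show thesis
  proof (rule that[OF M])
    fix w :: "'a list"
    assume w: "w \<noteq> []"
    have blank: "letter_of (word_contents w i) = None" if "i < 0 \<or> i \<ge> int (length w)" for i
      using that by (auto simp: word_contents_def)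
    have letter: "letter_of (word_contents w (int i)) = Some (w ! i)" if "i < length w" for i
      using that by (simp add: word_contents_def)
    \<comment> \<open>From cell \<open>i - 1\<close> the head makes \<open>i\<close> moves to the
      left over letters; the blank in cell -1 then sends it right to cell 0, where the pass
      begins.\<close>
    have rewind: "reach (i + 1) (conf w (p, None) (int i - 1) out)
        (conf w (p, Some (fst (snd (ps ! p)))) 0 (out @ fst (ps ! p)))"
      if "p < length ps" "i \<le> length w" for p i out
      using that(2)
    proof (induction i)
      case 0
      have "D (p, None) (letter_of (word_contents w (-1))) =
        Some ((p, Some (fst (snd (ps ! p)))), fst (ps ! p), MoveRight)"
        using that by (simp add: D_def blank split: prod.split)
      from stp1[OF _ this, of out] show ?case using that by (simp add: Q_def)
    next
      case (Suc i)
      have "D (p, None) (letter_of (word_contents w (int i))) = Some ((p, None), [], MoveLeft)"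
        using that Suc.prems by (simp add: D_def letter split: prod.split)
      from stp1[OF _ this, of out] have "reach 1 (conf w (p, None) (int i) out)
          (conf w (p, None) (int i - 1) out)" using that by (simp add: Q_def)
      from trans[OF this Suc.IH] Suc.prems show ?case by simp
    qed
    have scan: "reach (length v) (conf w (p, Some s) (int i) out)
        (conf w (p, Some (fst (run (snd (snd (ps ! p))) s v))) (int (length w))
          (out @ snd (run (snd (snd (ps ! p))) s v)))"
      if "p < length ps" "v = drop i w" "i \<le> length w" for p i v s out
      using that(2,3)
    proof (induction v arbitrary: i s out)
      case Nil
      then show ?case by (simp add: refl)
    next
      case (Cons a v)
      have i: "i < length w" using Cons.prems by (metis drop_all leI list.discI)
      then have a: "a = w ! i" "v = drop (Suc i) w"
        using Cons.prems(1) by (metis Cons_nth_drop_Suc list.inject)+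
      obtain s' x where sx: "snd (snd (ps ! p)) s a = (s', x)" by fastforce
      have "D (p, Some s) (letter_of (word_contents w (int i))) = Some ((p, Some s'), x, MoveRight)"
        using that(1) sx i by (cases "ps ! p") (simp add: D_def letter a)
      from stp1[OF _ this, of out] have 1: "reach 1 (conf w (p, Some s) (int i) out)
          (conf w (p, Some s') (int (Suc i)) (out @ x))" using that(1) by (simp add: Q_def add.commute)
      have "Suc i \<le> length w" using i by simp
      from trans[OF 1 Cons.IH[OF a(2) this]] show ?case
        by (simp add: sx case_prod_beta)
    qed
    have one_pass: "reach (2 * length w + 2) (conf w (p, None) (int i - 1) out)
        (conf w (Suc p, None) (int (length w) - 1) (out @ pass_output (ps ! p) w))"
      if "p < length ps" "i \<le> length w" for p i out
    proof -
      obtain u s0 \<delta> where p: "ps ! p = (u, s0, \<delta>)" by (cases "ps ! p") blast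
      have b: "reach (i + 1) (conf w (p, None) (int i - 1) out) (conf w (p, Some s0) 0 (out @ u))"
        using rewind[OF that, of out] by (simp add: p)
      have s: "reach (length w) (conf w (p, Some s0) 0 (out @ u))
        (conf w (p, Some (fst (run \<delta> s0 w))) (int (length w)) (out @ pass_output (ps ! p) w))"
        using scan[OF that(1), of w 0 s0 "out @ u"] by (simp add: p)
      have "D (p, Some (fst (run \<delta> s0 w))) (letter_of (word_contents w (int (length w)))) =
        Some ((Suc p, None), [], MoveLeft)"
        using that(1) by (simp add: D_def blank p)
      from stp1[OF _ this, of "out @ pass_output (ps ! p) w"]
      have e: "reach 1 (conf w (p, Some (fst (run \<delta> s0 w))) (int (length w)) (out @ pass_output (ps ! p) w))
        (conf w (Suc p, None) (int (length w) - 1) (out @ pass_output (ps ! p) w))"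
        using that(1) by (simp add: Q_def)
      \<comment> \<open>The summands are the rewinding, the scan, and the move back from the blank
        after the input; \<open>i = length w\<close> is the worst case.\<close>
      have "reach (i + 1 + length w + 1) (conf w (p, None) (int i - 1) out)
        (conf w (Suc p, None) (int (length w) - 1) (out @ pass_output (ps ! p) w))"
        by (rule trans[OF trans[OF b s] e])
      moreover have "(i + 1 + length w + 1) * Suc K \<le> (2 * length w + 2) * Suc K"
        using that(2) by (intro mult_right_mono) auto
      ultimately show ?thesis unfolding reach_def using order_trans by blast
    qed
    have "\<exists>j. reach (p * (2 * length w + 2)) (conf w (0, None) 0 []) (conf w (p, None) j
        (concat (map (\<lambda>p. pass_output p w) (take p ps)))) \<and> (\<exists>i \<le> length w. j = int i - 1)"
      if "p \<le> length ps" for p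
      using that
    proof (induction p)
      case 0
      \<comment> \<open>The initial cell 0 is of the form \<open>int i - 1\<close> with
        \<open>i = 1\<close>, and \<open>i \<le> length w\<close> holds as the input is
        nonempty.\<close>
      have "(0::int) = int 1 - 1 \<and> 1 \<le> length w" using w by (simp add: Suc_le_eq)
      then show ?case using refl[of "conf w (0, None) 0 []"] by auto
    next
      case (Suc p)
      then obtain i where i: "i \<le> length w" "reach (p * (2 * length w + 2)) (conf w (0, None) 0 [])
        (conf w (p, None) (int i - 1) (concat (map (\<lambda>p. pass_output p w) (take p ps))))" by auto
      from trans[OF i(2) one_pass[OF _ i(1)]] Suc.prems
      have "reach (Suc p * (2 * length w + 2)) (conf w (0, None) 0 []) (conf w (Suc p, None)
        (int (length w) - 1) (concat (map (\<lambda>p. pass_output p w) (take (Suc p) ps))))"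
        by (simp add: take_Suc_conv_app_nth ac_simps)
      then show ?case by blast
    qed
    from this[of "length ps"] obtain j m where m: "m \<le> length ps * (2 * length w + 2) * Suc K"
      "(step M ^^ m) (conf w (0, None) 0 []) =
        conf w (length ps, None) j (concat (map (\<lambda>p. pass_output p w) ps))"
      by (auto simp: reach_def)
    have "halted M (conf w (length ps, None) j (concat (map (\<lambda>p. pass_output p w) ps)))"
      by (rule halt) (auto simp: Q_def D_def)
    then have "outputs_within M w (concat (map (\<lambda>p. pass_output p w) ps)) m"
      using m(2) by (simp add: outputs_within_def init out[simplified])
    moreover have "m \<le> 2 * length ps * Suc K * (length w + 1)" using m(1) by (simp add: algebra_simps)
    ultimately show "outputs_within M w (concat (map (\<lambda>p. pass_output p w) ps))
      (2 * length ps * Suc K * (length w + 1))" by (rule outputs_within_mono)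
  qed
qed

lemma passes_exp_time_computable:
  fixes ps :: "('s::finite, 'a::finite) pass list"
  assumes "\<And>x. x \<in> A \<Longrightarrow> enc_in x \<noteq> []"
    and "\<And>x. x \<in> A \<Longrightarrow> enc_out (f x) = concat (map (\<lambda>p. pass_output p (enc_in x)) ps)"
  shows "exp_time_computable_on A enc_in enc_out f"
proof -
  obtain M :: "'a tm" and c where M: "is_tm M"
    "\<And>w. w \<noteq> [] \<Longrightarrow>
      outputs_within M w (concat (map (\<lambda>p. pass_output p w) ps)) (c * (length w + 1))"
    using passes_tm[of ps] by blast
  \<comment> \<open>The linear bound is at most \<open>2 ^ c * 2 ^ n\<close>, which gives the
    exponent c + X.\<close>
  have "c * (n + 1) \<le> 2 ^ poly [:c, 1:] n" for n
  proof -
    have "c * (n + 1) \<le> 2 ^ c * 2 ^ n"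
      using less_exp[of n] less_exp[of c] by (intro mult_mono) (auto simp: Suc_le_eq)
    then show ?thesis by (simp add: power_add)
  qed
  then have "outputs_within M (enc_in x) (enc_out (f x)) (2 ^ poly [:c, 1:] (length (enc_in x)))"
    if "x \<in> A" for x
    using outputs_within_mono[OF M(2)[OF assms(1)[OF that]]] assms(2)[OF that] by metis
  then show ?thesis using M(1) unfolding exp_time_computable_on_def by blast
qed

section \<open>Computing the extension\<close>

instance sort :: finite
proof
  have "(UNIV :: sort set) = {DSort, QSort}" using sort.exhaust by blast
  then show "finite (UNIV :: sort set)" by (metis finite.simps)
qed

text \<open>The first component of a state is the sort of the last atom, the second one tells whether the
  bits being read belong to the index of a variable to be quantified.\<close>

fun quant_step :: "sort \<times> bool \<Rightarrow> token \<Rightarrow> (sort \<times> bool) \<times> token list" where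
  "quant_step (s, b) (TDAtom r) = ((DSort, b), [])"
| "quant_step (s, b) (TQAtom r) = ((QSort, b), [])"
| "quant_step (s, b) TSnd = ((s, True), [TEx, TBnd s, TBit False, TBit True])"
| "quant_step (s, b) (TBit x) = ((s, b), if b then [TBit x] else [])"
| "quant_step (s, b) TEnd = ((s, False), if b then [TEnd] else [])"
| "quant_step (s, b) t = ((s, b), [])"

text \<open>The two fixed bits can be emitted right after the token that opens a variable, since
  numbers are written with the least significant bit first. The Boolean is carried along so that all
  passes share one state type.\<close>

fun inst_step :: "token \<Rightarrow> sort \<times> bool \<Rightarrow> token \<Rightarrow> (sort \<times> bool) \<times> token list" where
  "inst_step h (s, b) (TDAtom r) = ((DSort, b), [TDAtom r])"
| "inst_step h (s, b) (TQAtom r) = ((QSort, b), [TQAtom r])"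
| "inst_step h (s, b) TFst = ((s, b), [h])"
| "inst_step h (s, b) TSnd = ((s, b), [TBnd s, TBit False, TBit True])"
| "inst_step h (s, b) (TBnd s') = ((s, b), [TBnd s', TBit True, TBit True])"
| "inst_step h (s, b) t = ((s, b), [t])"

section \<open>Correctness of the passes on words\<close>

lemma bits_double: "n > 0 \<Longrightarrow> bits (2 * n) = False # bits n" "bits (2 * n + 1) = True # bits n"
  by (subst bits.simps; simp)+

text \<open>Zero has no bits, so doubling it would not prepend one. Setting the second bit makes the
  number to be doubled positive, and the prefix is then the same for every \<open>i\<close>,
  including 0.\<close>

lemma enc_nat_index:
  "enc_nat (z_index i) = TBit False # TBit True # enc_nat i"
  "enc_nat (bnd_index i) = TBit True # TBit True # enc_nat i"
proof -
  have "z_index i = 2 * (2 * i + 1)" "bnd_index i = 2 * (2 * i + 1) + 1"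
    by (simp_all add: z_index_def bnd_index_def)
  then show "enc_nat (z_index i) = TBit False # TBit True # enc_nat i"
    "enc_nat (bnd_index i) = TBit True # TBit True # enc_nat i"
    unfolding enc_nat_def
    by (simp_all only: bits_double) (simp_all add: bits_double del: add_2_eq_Suc' One_nat_def)
qed

definition enc_quants :: "(sort \<times> nat) list \<Rightarrow> token list" where
  "enc_quants xs = concat (map (\<lambda>(s, i). TEx # enc_var (Bnd s (z_index i))) xs)"

lemma enc_quants_simps [simp]:
  "enc_quants [] = []"
  "enc_quants (xs @ ys) = enc_quants xs @ enc_quants ys"
  by (simp_all add: enc_quants_def)

lemma enc_fm_ex_snd: "enc_fm name (ex_snd xs \<phi>) = enc_quants xs @ enc_fm name \<phi>"
  by (induction xs) (auto simp: enc_quants_def ex_snd_def)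

lemma run_quant_bits:
  "run quant_step (s, b) (map TBit bs) = ((s, b), if b then map TBit bs else [])"
  by (induction bs) auto

lemma run_quant_nat:
  "run quant_step (s, b) (enc_nat n) = ((s, False), if b then enc_nat n else [])"
  unfolding enc_nat_def by (rule run_append[OF run_quant_bits, THEN trans]) auto

lemma run_quant_var:
  "run quant_step (s, False) (enc_var x) = ((s, False), enc_quants (snd_var s x))"
  by (cases x) (auto simp: run_quant_nat enc_quants_def enc_nat_index)

lemma run_quant_int: "run quant_step (s, False) (enc_int z) = ((s, False), [])"
  by (simp add: enc_int_def run_quant_nat)

lemma run_quant_rat: "run quant_step (s, False) (enc_rat q) = ((s, False), [])"
  unfolding enc_rat_def by (rule run_append[OF run_quant_int run_quant_int, THEN trans]) simp

lemma run_quant_rhs: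
  assumes "\<And>c. run quant_step (s, False) (enc_c c) = ((s, False), [])"
  shows "run quant_step (s, False) (enc_rhs enc_c u) = ((s, False), enc_quants (snd_rhs s u))"
  using assms by (cases u) (auto simp: run_quant_var)

lemma run_inst_bits: "run (inst_step h) st (map TBit bs) = (st, map TBit bs)"
  by (induction bs) (cases st, auto)+

lemma run_inst_nat: "run (inst_step h) st (enc_nat n) = (st, enc_nat n)"
  unfolding enc_nat_def by (rule run_append[OF run_inst_bits, THEN trans]) (cases st, auto)+

lemma run_inst_var:
  assumes "\<And>i. enc_var (g i) = h # enc_nat i"
  shows "run (inst_step h) (s, b) (enc_var x) = ((s, b), enc_var (inst_var g s x))"
  using assms by (cases x) (auto simp: run_inst_nat enc_nat_index)

lemma run_inst_int: "run (inst_step h) (s, b) (enc_int z) = ((s, b), enc_int z)"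
  by (simp add: enc_int_def run_inst_nat)

lemma run_inst_rat: "run (inst_step h) (s, b) (enc_rat q) = ((s, b), enc_rat q)"
  unfolding enc_rat_def by (rule run_append[OF run_inst_int run_inst_int])

lemma run_inst_rhs:
  assumes "\<And>i. enc_var (g i) = h # enc_nat i"
    and "\<And>c. run (inst_step h) (s, b) (enc_c c) = ((s, b), enc_c c)"
  shows "run (inst_step h) (s, b) (enc_rhs enc_c u) = ((s, b), enc_rhs enc_c (inst_rhs g s u))"
  using assms by (cases u) (auto simp: run_inst_var[OF assms(1)])

text \<open>Between subformulas the sort in the state is arbitrary, since every atom sets it anew.\<close>

definition translates :: "(sort \<times> bool \<Rightarrow> token \<Rightarrow> (sort \<times> bool) \<times> token list) \<Rightarrow>
    token list \<Rightarrow> token list \<Rightarrow> bool" where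
  "translates \<delta> v u \<longleftrightarrow> (\<forall>s. \<exists>s'. run \<delta> (s, False) v = ((s', False), u))"

lemma translates_append:
  "translates \<delta> v x \<Longrightarrow> translates \<delta> w y \<Longrightarrow> translates \<delta> (v @ w) (x @ y)"
  unfolding translates_def by (meson run_append)

lemma translates_Cons:
  assumes "\<And>s. \<delta> (s, False) t = ((s, False), x)" "translates \<delta> w y"
  shows "translates \<delta> (t # w) (x @ y)"
  using translates_append[of \<delta> "[t]" x w y] assms by (auto simp: translates_def)

text \<open>Prefix notation makes a pass compositional: a head token is followed by the words of the
  parts. Constants and the given quantifiers emit nothing, because only \<open>TSnd\<close> switches
  copying on.\<close>

lemma translates_quant_fm:
  "translates quant_step (enc_fm name C) (enc_quants (snd_fm C))"
proof (induction C)
  case (DAtom r x u)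
  show ?case
    using run_append[OF run_quant_var run_quant_rhs[of DSort "\<lambda>c. enc_nat (name c)"]]
    by (simp add: translates_def run_quant_nat)
next
  case (QAtom r x u)
  show ?case
    using run_append[OF run_quant_var run_quant_rhs[of QSort "enc_rat"]]
    by (simp add: translates_def run_quant_rat)
next
  case (Neg C)
  then show ?case using translates_Cons[of quant_step TNeg "[]"] by simp
next
  case (Conj C D)
  then show ?case using translates_Cons[of quant_step TConj "[]"] translates_append by simp
next
  case (Disj C D)
  then show ?case using translates_Cons[of quant_step TDisj "[]"] translates_append by simp
next
  case (Impl C D)
  then show ?case using translates_Cons[of quant_step TImpl "[]"] translates_append by simp
next
  case (Ex s n C)
  have "translates quant_step (enc_var (Bnd s n)) []"
    by (auto simp: translates_def run_quant_nat)
  from translates_Cons[of quant_step TEx "[]", OF _ translates_append[OF this Ex.IH]]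
  show ?case by simp
next
  case (All s n C)
  have "translates quant_step (enc_var (Bnd s n)) []"
    by (auto simp: translates_def run_quant_nat)
  from translates_Cons[of quant_step TAll "[]", OF _ translates_append[OF this All.IH]]
  show ?case by simp
qed

lemma translates_inst_fm:
  assumes h: "\<And>i. enc_var (g i) = h # enc_nat i"
  shows "translates (inst_step h) (enc_fm name C) (enc_fm name (inst_fm g C))"
proof (induction C)
  case (DAtom r x u)
  show ?case
    using run_append[OF run_inst_var[OF h] run_inst_rhs[OF h, of DSort False "\<lambda>c. enc_nat (name c)"]]
    by (simp add: translates_def run_inst_nat)
next
  case (QAtom r x u)
  show ?case
    using run_append[OF run_inst_var[OF h] run_inst_rhs[OF h, of QSort False "enc_rat"]]
    by (simp add: translates_def run_inst_rat)
next
  case (Neg C)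
  then show ?case using translates_Cons[of "inst_step h" TNeg "[TNeg]"] by simp
next
  case (Conj C D)
  then show ?case
    using translates_Cons[of "inst_step h" TConj "[TConj]"] translates_append by simp
next
  case (Disj C D)
  then show ?case
    using translates_Cons[of "inst_step h" TDisj "[TDisj]"] translates_append by simp
next
  case (Impl C D)
  then show ?case
    using translates_Cons[of "inst_step h" TImpl "[TImpl]"] translates_append by simp
next
  case (Ex s n C)
  have "translates (inst_step h) (enc_var (Bnd s n)) (enc_var (Bnd s (bnd_index n)))"
    by (auto simp: translates_def run_inst_nat enc_nat_index)
  from translates_Cons[of "inst_step h" TEx "[TEx]", OF _ translates_append[OF this Ex.IH]]
  show ?case by simp
next
  case (All s n C)
  have "translates (inst_step h) (enc_var (Bnd s n)) (enc_var (Bnd s (bnd_index n)))"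
    by (auto simp: translates_def run_inst_nat enc_nat_index)
  from translates_Cons[of "inst_step h" TAll "[TAll]", OF _ translates_append[OF this All.IH]]
  show ?case by simp
qed

lemma pass_output_translates:
  "translates \<delta> v u \<Longrightarrow> pass_output (x, (s, False), \<delta>) v = x @ u"
  unfolding translates_def by (metis pass_output.simps snd_conv)

text \<open>After the quantifiers, the word consists of \<open>TConj\<close>, the first instance,
  \<open>TNeg\<close> and the second instance, so these two tokens become the initial outputs of the
  second and the third pass.\<close>

lemma exp_time_computable_ext_fm:
  "exp_time_computable_on A (enc_fm name) (enc_fm name) ext_fm"
proof (rule passes_exp_time_computable)
  show "enc_fm name C \<noteq> []" for C by (cases C) auto
  show "enc_fm name (ext_fm C) = concat (map (\<lambda>p. pass_output p (enc_fm name C))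
    [([], (DSort, False), quant_step), ([TConj], (DSort, False), inst_step TFst),
     ([TNeg], (DSort, False), inst_step TSnd)])" for C
    by (simp add: ext_fm_def enc_fm_ex_snd pass_output_translates[OF translates_quant_fm]
        pass_output_translates[OF translates_inst_fm[of Fst]]
        pass_output_translates[OF translates_inst_fm[of Snd]] del: pass_output.simps)
qed

theorem theorem15:
  fixes name :: "'d \<Rightarrow> nat"
  assumes "bij name"
  shows "\<exists>ext :: 'd fm \<Rightarrow> 'd fm.
    (\<forall>R C. ERO R C \<and> interval_order_on (tuples R) (pref R C) \<longrightarrow>
       ERO R (ext C) \<and> weak_order_on (tuples R) (pref R (ext C)) \<and>
       pref R C \<subseteq> pref R (ext C)) \<and>
    exp_time_computable_on {C. \<exists>R. ERO R C \<and> interval_order_on (tuples R) (pref R C)}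
      (enc_fm name) (enc_fm name) ext"
proof (intro exI[of _ ext_fm] conjI allI impI)
  fix R and C :: "'d fm"
  assume C: "ERO R C \<and> interval_order_on (tuples R) (pref R C)"
  then show "ERO R (ext_fm C)" by (blast intro: ERO_ext_fm)
  show "weak_order_on (tuples R) (pref R (ext_fm C))" "pref R C \<subseteq> pref R (ext_fm C)"
    using C weak_order_on_interval_order[of "tuples R" "pref R C"]
      interval_order_subset_extension[of "tuples R" "pref R C"]
    by (simp_all add: pref_ext_fm)
qed (rule exp_time_computable_ext_fm)

end
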